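(* Let $(X,\mu)$ and $(Y,\nu)$ be $\sigma$-finite measure spaces. Let $S:L^1(Y,\nu)\to L^1(X,\mu)$ be a stochastic operator and let $V$ be a finite dimensional subspace of $L^1(Y,\nu)$. Then there exists a sequence $\{S_k\}_{k=1}^\infty$ of stochastic integral operators from $L^1(Y,\nu)$ to $L^1(X,\mu)$ which converges to $S$ on $V$, i.e. $\lim_{k\to\infty}\|S_kf-Sf\|_{L^1(X,\mu)}=0$ for all $f\in V$.
   Context: All functions are real-valued. A linear operator $S:L^1(Y,\nu)\to L^1(X,\mu)$ (with $\mu,\nu$ $\sigma$-finite) is called a stochastic operator if it is positive (it maps nonnegative functions to nonnegative functions) and $\int_X Sf\,d\mu=\int_Y f\,d\nu$ for all $f\in L^1(Y,\nu)$. A stochastic kernel is a measurable function $K:X\times Y\to[0,\infty)$ such that $\int_X K(x,y)\,d\mu(x)=1$ for almost all $y\in Y$. A stochastic integral operator is an operator $M:L^1(Y,\nu)\to L^1(X,\mu)$ of the form $(Mg)(x)=\int_Y K(x,y)g(y)\,d\nu(y)$, where $K$ is a stochastic kernel. *)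

theory Defs
  imports "HOL-Analysis.Analysis"
begin

text \<open>
  An element of \<open>L\<^sup>1(M)\<close> is represented by any of its integrable representatives, so an operator
  between \<open>L\<^sup>1\<close> spaces is a map on functions that respects almost-everywhere equality, and
  identities in \<open>L\<^sup>1\<close> are almost-everywhere identities. The values of an operator
  on non-integrable functions are irrelevant.
\<close>

definition L1_norm :: "'a measure \<Rightarrow> ('a \<Rightarrow> real) \<Rightarrow> real" where
  "L1_norm M f = (LINT x|M. \<bar>f x\<bar>)"

definition L1_linear_operator ::
    "'b measure \<Rightarrow> 'a measure \<Rightarrow> (('b \<Rightarrow> real) \<Rightarrow> 'a \<Rightarrow> real) \<Rightarrow> bool" where
  "L1_linear_operator N M S \<longleftrightarrow>
     (\<forall>f. integrable N f \<longrightarrow> integrable M (S f)) \<and>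
     (\<forall>f g. integrable N f \<longrightarrow> integrable N g \<longrightarrow>
        (AE y in N. f y = g y) \<longrightarrow> (AE x in M. S f x = S g x)) \<and>
     (\<forall>f g. integrable N f \<longrightarrow> integrable N g \<longrightarrow>
        (AE x in M. S (\<lambda>y. f y + g y) x = S f x + S g x)) \<and>
     (\<forall>c f. integrable N f \<longrightarrow> (AE x in M. S (\<lambda>y. c * f y) x = c * S f x))"

definition stochastic_operator ::
    "'b measure \<Rightarrow> 'a measure \<Rightarrow> (('b \<Rightarrow> real) \<Rightarrow> 'a \<Rightarrow> real) \<Rightarrow> bool" where
  "stochastic_operator N M S \<longleftrightarrow>
     L1_linear_operator N M S \<and>
     (\<forall>f. integrable N f \<longrightarrow> (AE y in N. 0 \<le> f y) \<longrightarrow> (AE x in M. 0 \<le> S f x)) \<and>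
     (\<forall>f. integrable N f \<longrightarrow> (LINT x|M. S f x) = (LINT y|N. f y))"

definition stochastic_kernel ::
    "'b measure \<Rightarrow> 'a measure \<Rightarrow> ('a \<times> 'b \<Rightarrow> real) \<Rightarrow> bool" where
  "stochastic_kernel N M K \<longleftrightarrow>
     K \<in> borel_measurable (M \<Otimes>\<^sub>M N) \<and>
     (\<forall>x\<in>space M. \<forall>y\<in>space N. 0 \<le> K (x, y)) \<and>
     (AE y in N. (\<integral>\<^sup>+ x. ennreal (K (x, y)) \<partial>M) = 1)"

definition stochastic_integral_operator ::
    "'b measure \<Rightarrow> 'a measure \<Rightarrow> (('b \<Rightarrow> real) \<Rightarrow> 'a \<Rightarrow> real) \<Rightarrow> bool" where
  "stochastic_integral_operator N M T \<longleftrightarrow>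
     L1_linear_operator N M T \<and>
     (\<exists>K. stochastic_kernel N M K \<and>
        (\<forall>g. integrable N g \<longrightarrow> (AE x in M. T g x = (LINT y|N. K (x, y) * g y))))"

text \<open>
  A subspace of \<open>L\<^sup>1(N)\<close> is represented by the set of all representatives of its elements; hence
  the closure under almost-everywhere equality.
\<close>

definition L1_subspace :: "'b measure \<Rightarrow> ('b \<Rightarrow> real) set \<Rightarrow> bool" where
  "L1_subspace N V \<longleftrightarrow>
     (\<forall>f\<in>V. integrable N f) \<and>
     (\<forall>f\<in>V. \<forall>g. integrable N g \<longrightarrow> (AE y in N. f y = g y) \<longrightarrow> g \<in> V) \<and>
     (\<lambda>y. 0) \<in> V \<and>
     (\<forall>f\<in>V. \<forall>g\<in>V. (\<lambda>y. f y + g y) \<in> V) \<and>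
     (\<forall>c. \<forall>f\<in>V. (\<lambda>y. c * f y) \<in> V)"

definition L1_finite_dimensional :: "'b measure \<Rightarrow> ('b \<Rightarrow> real) set \<Rightarrow> bool" where
  "L1_finite_dimensional N V \<longleftrightarrow>
     (\<exists>B. finite B \<and> B \<subseteq> V \<and>
        (\<forall>f\<in>V. \<exists>c. AE y in N. f y = (\<Sum>b\<in>B. c b * b y)))"

end

theory Submission imports Defs begin

text \<open>
  The idea is to replace \<open>S\<close> by \<open>S\<close> composed with a conditional expectation. Partition \<open>Y\<close> into
  finitely many measurable cells \<open>A\<close>, and let \<open>T g = \<Sum>A. (\<integral>\<^sub>A g d\<nu>) d A\<close>, where each \<open>d A\<close> is a
  probability density on \<open>X\<close>. This is an integral operator; its kernel \<open>K(x,y)\<close> is the density of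
  the cell of \<open>y\<close>, evaluated at \<open>x\<close>, so that \<open>K\<close> is stochastic for every choice of the densities.
  Write \<open>1 A\<close> for the indicator of \<open>A\<close>. If \<open>A\<close> has finite positive measure, then
  \<open>S (1 A) / \<nu>(A)\<close> is such a density, and with this choice \<open>T (1 A) = S (1 A)\<close>. An integrable
  function that is constant on the cells vanishes on the cells of infinite measure, and null cells
  are invisible in \<open>L\<^sup>1\<close>, so an arbitrary density serves for those cells; one exists if \<open>Y\<close> is not
  null, since \<open>S\<close> maps densities to densities. Thus \<open>T\<close> agrees with \<open>S\<close> on every integrable
  function that is constant on the cells (\<open>exists_cell_kernel_operator_agreeing\<close>).

  Now let \<open>B\<close> be a finite spanning set of \<open>V\<close> and approximate every \<open>b \<in> B\<close> in \<open>L\<^sup>1\<close> by integrable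
  simple functions \<open>s b k\<close>. The cells for \<open>T k\<close> are the fibres of the joint map
  \<open>y \<mapsto> (s b k y)\<^bsub>b \<in> B\<^esub>\<close>, which takes finitely many values because \<open>B\<close> is finite. If
  \<open>f = \<Sum> c b b\<close>, then \<open>g = \<Sum> c b (s b k)\<close> is constant on the cells, hence \<open>T k g = S g\<close>. Stochastic
  operators are contractions, so \<open>T k f - S f = T k (f - g) - S (f - g)\<close> has norm at most
  \<open>2 \<parallel>f - g\<parallel>\<close> (\<open>L1_dist_le_of_agreement\<close>), which tends to \<open>0\<close>.
\<close>

section \<open>Operators on \<open>L\<^sup>1\<close> and their contraction property\<close>

text \<open>
  Nonnegativity is demanded at every point, because the kernels built from densities must be
  pointwise nonnegative.
\<close>
definition prob_density :: "'a measure \<Rightarrow> ('a \<Rightarrow> real) \<Rightarrow> bool" where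
  "prob_density M d \<longleftrightarrow> integrable M d \<and> (\<forall>x. 0 \<le> d x) \<and> (LINT x|M. d x) = 1"

lemma L1_linear_operatorD:
  assumes "L1_linear_operator N M S"
  shows L1_linear_integrable: "integrable N f \<Longrightarrow> integrable M (S f)"
    and L1_linear_cong_AE: "integrable N f \<Longrightarrow> integrable N g \<Longrightarrow> AE y in N. f y = g y \<Longrightarrow>
        AE x in M. S f x = S g x"
    and L1_linear_add: "integrable N f \<Longrightarrow> integrable N g \<Longrightarrow>
        AE x in M. S (\<lambda>y. f y + g y) x = S f x + S g x"
    and L1_linear_scale: "integrable N f \<Longrightarrow> AE x in M. S (\<lambda>y. c * f y) x = c * S f x"
  using assms unfolding L1_linear_operator_def by blast+

lemma stochastic_operatorD:
  assumes "stochastic_operator N M S"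
  shows stochastic_linear: "L1_linear_operator N M S"
    and stochastic_positive: "integrable N f \<Longrightarrow> AE y in N. 0 \<le> f y \<Longrightarrow> AE x in M. 0 \<le> S f x"
    and stochastic_integral: "integrable N f \<Longrightarrow> (LINT x|M. S f x) = (LINT y|N. f y)"
  using assms unfolding stochastic_operator_def by blast+

lemma L1_linear_zero:
  assumes "L1_linear_operator N M S"
  shows "AE x in M. S (\<lambda>y. 0) x = 0"
  using L1_linear_scale[OF assms, of "\<lambda>y. 0" 0] by simp

lemma L1_linear_diff:
  assumes S: "L1_linear_operator N M S" and f: "integrable N f" and g: "integrable N g"
  shows "AE x in M. S (\<lambda>y. f y - g y) x = S f x - S g x"
proof -
  have g': "integrable N (\<lambda>y. - 1 * g y)" using g by simp
  show ?thesis
    using L1_linear_add[OF S f g'] L1_linear_scale[OF S g, of "- 1"] by eventually_elim simp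
qed

lemma L1_linear_sum:
  assumes S: "L1_linear_operator N M S" and "finite I" and "\<And>i. i \<in> I \<Longrightarrow> integrable N (f i)"
  shows "AE x in M. S (\<lambda>y. \<Sum>i\<in>I. f i y) x = (\<Sum>i\<in>I. S (f i) x)"
  using assms(2,3)
proof (induction I rule: finite_induct)
  case empty
  then show ?case using L1_linear_zero[OF S] by simp
next
  case (insert j I)
  have "AE x in M. S (\<lambda>y. f j y + (\<Sum>i\<in>I. f i y)) x = S (f j) x + S (\<lambda>y. \<Sum>i\<in>I. f i y) x"
    by (rule L1_linear_add[OF S]) (use insert in auto)
  moreover have "AE x in M. S (\<lambda>y. \<Sum>i\<in>I. f i y) x = (\<Sum>i\<in>I. S (f i) x)"
    using insert by simp
  ultimately show ?case
    by eventually_elim (use insert in simp)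
qed

text \<open>
  Positivity applied to \<open>\<bar>f\<bar> + f\<close> and \<open>\<bar>f\<bar> - f\<close> gives \<open>\<bar>S f\<bar> \<le> S \<bar>f\<bar>\<close>, and the integral of the
  right-hand side is that of \<open>\<bar>f\<bar>\<close>.
\<close>
lemma stochastic_operator_contraction:
  assumes S: "stochastic_operator N M S" and f: "integrable N f"
  shows "L1_norm M (S f) \<le> L1_norm N f"
proof -
  note L = stochastic_linear[OF S]
  have a: "integrable N (\<lambda>y. \<bar>f y\<bar>)" using f by simp
  have "AE x in M. 0 \<le> S (\<lambda>y. \<bar>f y\<bar> + f y) x"
    by (rule stochastic_positive[OF S]) (use f in auto)
  moreover have "AE x in M. 0 \<le> S (\<lambda>y. \<bar>f y\<bar> - f y) x"
    by (rule stochastic_positive[OF S]) (use f in auto)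
  ultimately have "AE x in M. \<bar>S f x\<bar> \<le> S (\<lambda>y. \<bar>f y\<bar>) x"
    using L1_linear_add[OF L a f] L1_linear_diff[OF L a f] by eventually_elim linarith
  then have "L1_norm M (S f) \<le> (LINT x|M. S (\<lambda>y. \<bar>f y\<bar>) x)"
    unfolding L1_norm_def
    by (intro integral_mono_AE) (use L1_linear_integrable[OF L] f a in auto)
  also have "\<dots> = L1_norm N f"
    unfolding L1_norm_def by (rule stochastic_integral[OF S a])
  finally show ?thesis .
qed

text \<open>
  The terms \<open>T g\<close> and \<open>S g\<close> cancel, so that \<open>T f - S f = T (f - g) - S (f - g)\<close>; both parts are
  controlled by the contraction property.
\<close>
lemma L1_dist_le_of_agreement:
  assumes S: "stochastic_operator N M S" and T: "stochastic_operator N M T"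
    and f: "integrable N f" and g: "integrable N g"
    and agree: "AE x in M. T g x = S g x"
  shows "L1_norm M (\<lambda>x. T f x - S f x) \<le> 2 * L1_norm N (\<lambda>y. f y - g y)"
proof -
  note LS = stochastic_linear[OF S] and LT = stochastic_linear[OF T]
  let ?h = "\<lambda>y. f y - g y"
  have h: "integrable N ?h" using f g by simp
  note hS = L1_linear_integrable[OF LS] and hT = L1_linear_integrable[OF LT]
  have "AE x in M. \<bar>T f x - S f x\<bar> \<le> \<bar>T ?h x\<bar> + \<bar>S ?h x\<bar>"
    using L1_linear_diff[OF LS f g] L1_linear_diff[OF LT f g] agree
    by eventually_elim linarith
  then have "L1_norm M (\<lambda>x. T f x - S f x) \<le> (LINT x|M. \<bar>T ?h x\<bar> + \<bar>S ?h x\<bar>)"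
    unfolding L1_norm_def
    by (intro integral_mono_AE) (use hS[OF h] hT[OF h] hS[OF f] hT[OF f] in auto)
  also have "\<dots> = L1_norm M (T ?h) + L1_norm M (S ?h)"
    unfolding L1_norm_def using hS[OF h] hT[OF h] by simp
  also have "\<dots> \<le> 2 * L1_norm N ?h"
    using stochastic_operator_contraction[OF S h] stochastic_operator_contraction[OF T h] by simp
  finally show ?thesis .
qed

text \<open>
  The image of a density is nonnegative only almost everywhere; its positive part is the
  representative that is nonnegative at every point.
\<close>
lemma stochastic_operator_prob_density:
  assumes S: "stochastic_operator N M S" and f: "integrable N f" "AE y in N. 0 \<le> f y"
    and one: "(LINT y|N. f y) = 1"
  obtains d where "prob_density M d" and "AE x in M. S f x = d x"
proof
  note Sf = L1_linear_integrable[OF stochastic_linear[OF S] f(1)]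
  let ?d = "\<lambda>x. max 0 (S f x)"
  show eq: "AE x in M. S f x = ?d x"
    using stochastic_positive[OF S f] by eventually_elim simp
  have "(LINT x|M. ?d x) = (LINT x|M. S f x)"
    by (rule integral_cong_AE) (use Sf eq in auto)
  then show "prob_density M ?d"
    using Sf stochastic_integral[OF S f(1)] one unfolding prob_density_def by auto
qed

section \<open>Kernels that are constant on the cells of a finite partition\<close>

text \<open>
  A finite measurable partition is given by a simple function \<open>F\<close> with values in an arbitrary type
  of labels: its cells are the fibres of \<open>F\<close>. The kernel assigns to a point \<open>y\<close> the density that
  belongs to its label.
\<close>
definition cell_kernel_operator ::
    "'b measure \<Rightarrow> ('c \<Rightarrow> 'a \<Rightarrow> real) \<Rightarrow> ('b \<Rightarrow> 'c) \<Rightarrow> ('b \<Rightarrow> real) \<Rightarrow> 'a \<Rightarrow> real" where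
  "cell_kernel_operator N d F g x = (LINT y|N. d (F y) x * g y)"

abbreviation cell :: "'b measure \<Rightarrow> ('b \<Rightarrow> 'c) \<Rightarrow> 'c \<Rightarrow> 'b set" where
  "cell N F v \<equiv> F -` {v} \<inter> space N"

lemma sum_over_cells:
  fixes k :: "'c \<Rightarrow> real"
  assumes "finite (F ` space N)" and "y \<in> space N"
  shows "(\<Sum>v\<in>F ` space N. indicator (cell N F v) y * k v) = k (F y)"
proof -
  have "(\<Sum>v\<in>F ` space N. indicator (cell N F v) y * k v)
      = (\<Sum>v\<in>F ` space N. if F y = v then k v else 0)"
    using assms(2) by (intro sum.cong) (auto simp: indicator_def)
  then show ?thesis using assms by simp
qed

lemma integrable_on_cell:
  fixes g :: "'b \<Rightarrow> real"
  assumes "simple_function N F" and "integrable N g" and "v \<in> F ` space N"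
  shows "integrable N (\<lambda>y. indicator (cell N F v) y * g y)"
  using integrable_real_mult_indicator[OF simple_functionD(2)[OF assms(1), of "{v}"] assms(2)]
  by (simp add: mult.commute)

lemma cell_kernel_operator_eq_sum:
  assumes F: "simple_function N F" and g: "integrable N g"
  shows "cell_kernel_operator N d F g x
    = (\<Sum>v\<in>F ` space N. (LINT y|N. indicator (cell N F v) y * g y) * d v x)"
proof -
  have fin: "finite (F ` space N)" using F by (simp add: simple_function_def)
  have "cell_kernel_operator N d F g x
      = (LINT y|N. (\<Sum>v\<in>F ` space N. (indicator (cell N F v) y * g y) * d v x))"
    unfolding cell_kernel_operator_def
  proof (rule Bochner_Integration.integral_cong)
    fix y assume "y \<in> space N"
    then show "d (F y) x * g y = (\<Sum>v\<in>F ` space N. (indicator (cell N F v) y * g y) * d v x)"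
      using sum_over_cells[OF fin, of y "\<lambda>v. g y * d v x"] by (simp add: mult_ac)
  qed simp
  also have "\<dots> = (\<Sum>v\<in>F ` space N. (LINT y|N. indicator (cell N F v) y * g y) * d v x)"
    using integrable_on_cell[OF F g]
    by (subst Bochner_Integration.integral_sum) auto
  finally show ?thesis .
qed

lemma sum_cell_integrals:
  fixes g :: "'b \<Rightarrow> real"
  assumes F: "simple_function N F" and g: "integrable N g"
  shows "(\<Sum>v\<in>F ` space N. (LINT y|N. indicator (cell N F v) y * g y)) = (LINT y|N. g y)"
proof -
  have fin: "finite (F ` space N)" using F by (simp add: simple_function_def)
  have "(\<Sum>v\<in>F ` space N. (LINT y|N. indicator (cell N F v) y * g y))
      = (LINT y|N. (\<Sum>v\<in>F ` space N. indicator (cell N F v) y * g y))"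
    using integrable_on_cell[OF F g] by (subst Bochner_Integration.integral_sum) auto
  also have "\<dots> = (LINT y|N. g y)"
    by (rule Bochner_Integration.integral_cong) (use sum_over_cells[OF fin] in auto)
  finally show ?thesis .
qed

lemma cell_kernel_operator_linear:
  fixes N :: "'b measure"
  assumes F: "simple_function N F" and d: "\<And>v. prob_density M (d v)"
  shows "L1_linear_operator N M (cell_kernel_operator N d F)"
proof -
  let ?T = "cell_kernel_operator N d F"
  note T = cell_kernel_operator_eq_sum[OF F]
  show ?thesis
    unfolding L1_linear_operator_def
  proof (intro conjI allI impI)
    show "integrable M (?T f)" if "integrable N f" for f
      unfolding T[OF that, abs_def] using d by (auto simp: prob_density_def)
  next
    fix f g :: "'b \<Rightarrow> real"
    assume f: "integrable N f" and g: "integrable N g" and eq: "AE y in N. f y = g y"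
    have "(LINT y|N. indicator (cell N F v) y * f y) = (LINT y|N. indicator (cell N F v) y * g y)"
      if v: "v \<in> F ` space N" for v
    proof (rule integral_cong_AE)
      show "AE y in N. indicator (cell N F v) y * f y = indicator (cell N F v) y * g y"
        using eq by eventually_elim simp
    qed (use integrable_on_cell[OF F _ v] f g in auto)
    then show "AE x in M. ?T f x = ?T g x"
      using f g by (simp add: T)
  next
    show "AE x in M. ?T (\<lambda>y. f y + g y) x = ?T f x + ?T g x"
      if "integrable N f" "integrable N g" for f g
      using that integrable_on_cell[OF F]
      by (simp add: T distrib_left distrib_right sum.distrib)
  next
    show "AE x in M. ?T (\<lambda>y. c * f y) x = c * ?T f x" if "integrable N f" for c f
      using that by (simp add: T sum_distrib_left mult.assoc mult.left_commute[of _ c])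
  qed
qed

lemma cell_kernel_operator_stochastic:
  fixes N :: "'b measure"
  assumes F: "simple_function N F" and d: "\<And>v. prob_density M (d v)"
  shows "stochastic_operator N M (cell_kernel_operator N d F)"
  unfolding stochastic_operator_def
proof (intro conjI allI impI)
  show "L1_linear_operator N M (cell_kernel_operator N d F)"
    using assms by (rule cell_kernel_operator_linear)
next
  fix f :: "'b \<Rightarrow> real" assume f: "AE y in N. 0 \<le> f y"
  have nonneg: "0 \<le> d v x" for v x using d by (simp add: prob_density_def)
  have "AE y in N. 0 \<le> d (F y) x * f y" for x
    using f by eventually_elim (simp add: nonneg)
  then show "AE x in M. 0 \<le> cell_kernel_operator N d F f x"
    unfolding cell_kernel_operator_def by (intro AE_I2) (rule integral_nonneg_AE)
next
  fix f :: "'b \<Rightarrow> real" assume f: "integrable N f"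
  have "(LINT x|M. cell_kernel_operator N d F f x)
      = (\<Sum>v\<in>F ` space N. (LINT y|N. indicator (cell N F v) y * f y))"
    unfolding cell_kernel_operator_eq_sum[OF F f]
    using d by (subst Bochner_Integration.integral_sum) (auto simp: prob_density_def)
  then show "(LINT x|M. cell_kernel_operator N d F f x) = (LINT y|N. f y)"
    using sum_cell_integrals[OF F f] by simp
qed

lemma cell_kernel_operator_integral_operator:
  assumes F: "simple_function N F" and d: "\<And>v. prob_density M (d v)"
  shows "stochastic_integral_operator N M (cell_kernel_operator N d F)"
proof -
  let ?K = "\<lambda>z. d (F (snd z)) (fst z)"
  have fin: "finite (F ` space N)" using F by (simp add: simple_function_def)
  have "?K \<in> borel_measurable (M \<Otimes>\<^sub>M N) \<longleftrightarrow>
      (\<lambda>z. \<Sum>v\<in>F ` space N. indicator (cell N F v) (snd z) * d v (fst z))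
        \<in> borel_measurable (M \<Otimes>\<^sub>M N)"
    by (rule measurable_cong) (auto simp: space_pair_measure sum_over_cells[OF fin])
  moreover have "(\<lambda>z. \<Sum>v\<in>F ` space N. indicator (cell N F v) (snd z) * d v (fst z))
        \<in> borel_measurable (M \<Otimes>\<^sub>M N)"
  proof (intro borel_measurable_sum borel_measurable_times)
    fix v assume "v \<in> F ` space N"
    then have "cell N F v \<in> sets N" using F simple_functionD(2) by blast
    then have [measurable]: "(indicator (cell N F v) :: _ \<Rightarrow> real) \<in> borel_measurable N" by simp
    have [measurable]: "d v \<in> borel_measurable M" using d by (auto simp: prob_density_def)
    show "(\<lambda>z. indicator (cell N F v) (snd z) :: real) \<in> borel_measurable (M \<Otimes>\<^sub>M N)"
      by (rule measurable_compose[OF measurable_snd]) simp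
    show "(\<lambda>z. d v (fst z)) \<in> borel_measurable (M \<Otimes>\<^sub>M N)" by measurable
  qed
  moreover have "(\<integral>\<^sup>+ x. ennreal (d v x) \<partial>M) = 1" for v
    using d[of v] by (subst nn_integral_eq_integral) (auto simp: prob_density_def)
  ultimately have "stochastic_kernel N M ?K"
    using d by (auto simp: stochastic_kernel_def prob_density_def)
  moreover have "L1_linear_operator N M (cell_kernel_operator N d F)"
    using assms by (rule cell_kernel_operator_linear)
  ultimately show ?thesis
    unfolding stochastic_integral_operator_def
    by (intro conjI exI[of _ ?K]) (auto simp: cell_kernel_operator_def)
qed

section \<open>Agreement with a given operator on functions constant on the cells\<close>

text \<open>
  On a cell of finite positive measure the density is the image under \<open>S\<close> of the normalised
  indicator. On the other cells an integrable function with constant value vanishes almost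
  everywhere, so both sides of the identity are zero for every density. The assumptions that \<open>N\<close> is
  \<open>\<sigma>\<close>-finite and not null provide an integrable function of integral 1, hence at least one density
  on \<open>M\<close>.
\<close>
lemma exists_cell_densities:
  fixes N :: "'b measure"
  assumes N: "sigma_finite_measure N" and nonnull: "emeasure N (space N) \<noteq> 0"
    and S: "stochastic_operator N M S" and F: "simple_function N F"
  obtains d where "\<And>v. prob_density M (d v)"
    and "\<And>c g v. integrable N g \<Longrightarrow> v \<in> F ` space N \<Longrightarrow> (\<forall>y\<in>cell N F v. g y = c) \<Longrightarrow>
          AE x in M. S (\<lambda>y. indicator (cell N F v) y * g y) x
            = (LINT y|N. indicator (cell N F v) y * g y) * d v x"
proof -
  note L = stochastic_linear[OF S]
  obtain p :: "'b \<Rightarrow> real" where p: "p \<in> borel_measurable N" "\<And>y. 0 < p y" "integrable N p"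
    using sigma_finite_measure.obtain_positive_integrable_function[OF N] by metis
  have "(LINT y|N. p y) \<noteq> 0"
  proof
    assume "(LINT y|N. p y) = 0"
    then have "AE y in N. p y = 0"
      using p by (subst (asm) integral_nonneg_eq_0_iff_AE) (auto intro!: less_imp_le)
    then have "AE y in N. False" by eventually_elim (use p(2) in \<open>metis less_irrefl\<close>)
    then show False
      using nonnull by (simp add: eventually_False ae_filter_eq_bot_iff)
  qed
  moreover have "0 \<le> (LINT y|N. p y)" using p(2) by (simp add: integral_nonneg less_imp_le)
  ultimately obtain d0 where d0: "prob_density M d0"
    using stochastic_operator_prob_density[OF S, of "\<lambda>y. p y / (LINT y|N. p y)"] p
    by (force simp: less_imp_le)
  define good where "good v \<longleftrightarrow> v \<in> F ` space N \<and>
    emeasure N (cell N F v) < \<infinity> \<and> measure N (cell N F v) > 0" for v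
  have "\<exists>d. prob_density M d \<and> (good v \<longrightarrow>
      (AE x in M. S (\<lambda>y. indicator (cell N F v) y / measure N (cell N F v)) x = d x))" for v
  proof (cases "good v")
    case True
    have A: "cell N F v \<in> sets N" using F simple_functionD(2) by blast
    let ?u = "\<lambda>y. indicator (cell N F v) y / measure N (cell N F v)"
    have "integrable N ?u"
      using True A by (intro integrable_divide) (auto simp: good_def)
    moreover have "AE y in N. 0 \<le> ?u y" by simp
    moreover have "(LINT y|N. ?u y) = 1"
      using True A by (simp add: good_def)
    ultimately obtain e where "prob_density M e" "AE x in M. S ?u x = e x"
      by (rule stochastic_operator_prob_density[OF S])
    then show ?thesis by blast
  qed (use d0 in blast)
  then obtain d where d: "\<And>v. prob_density M (d v)"
    and Sd: "\<And>v. good v \<Longrightarrow>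
      AE x in M. S (\<lambda>y. indicator (cell N F v) y / measure N (cell N F v)) x = d v x"
    by metis
  show thesis
  proof (rule that[of d])
    fix c v and g :: "'b \<Rightarrow> real"
    assume g: "integrable N g" and v: "v \<in> F ` space N" and c: "\<forall>y\<in>cell N F v. g y = c"
    let ?A = "cell N F v"
    have A: "?A \<in> sets N" using F simple_functionD(2) by blast
    have eq: "(\<lambda>y. indicator ?A y * g y) = (\<lambda>y. indicator ?A y * c)"
      using c by (auto simp: fun_eq_iff indicator_def)
    have int: "integrable N (\<lambda>y. indicator ?A y * c)"
      using integrable_on_cell[OF F g v] unfolding eq .
    show "AE x in M. S (\<lambda>y. indicator ?A y * g y) x = (LINT y|N. indicator ?A y * g y) * d v x"
    proof (cases "good v")
      case True
      then have "integrable N (\<lambda>y. indicator ?A y / measure N ?A)"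
        using A by (intro integrable_divide) (auto simp: good_def)
      \<comment> \<open>The factor \<open>measure N ?A\<close> undoes the normalisation of the indicator.\<close>
      from L1_linear_scale[OF L this, of "c * measure N ?A"] Sd[OF True]
      show ?thesis unfolding eq
        by eventually_elim (use True A in \<open>simp add: good_def mult.commute\<close>)
    next
      case False
      have null: "AE y in N. indicator ?A y * c = 0"
      proof (cases "c = 0")
        case False
        then have "integrable N (\<lambda>y. indicator ?A y :: real)" using int by simp
        then have "emeasure N ?A < \<infinity>" using A by (simp add: integrable_indicator_iff)
        moreover from this have "measure N ?A = 0"
          using \<open>\<not> good v\<close> v unfolding good_def by (simp add: less_le)
        ultimately have "emeasure N ?A = 0"
          by (simp add: emeasure_eq_ennreal_measure)
        then have "AE y in N. y \<notin> ?A" using A by (intro AE_not_in null_setsI)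
        then show ?thesis by eventually_elim simp
      qed simp
      then have zero: "(LINT y|N. indicator ?A y * c) = 0"
        by (rule integral_eq_zero_AE)
      have "AE x in M. S (\<lambda>y. indicator ?A y * c) x = S (\<lambda>y. 0) x"
        by (rule L1_linear_cong_AE[OF L int _ null]) simp
      with L1_linear_zero[OF L] show ?thesis
        unfolding eq zero by eventually_elim simp
    qed
  qed (rule d)
qed

text \<open>
  A function that factors through \<open>F\<close> is a sum of its restrictions to the finitely many cells, and
  it is constant on each of them, so the identity on single cells adds up.
\<close>
lemma exists_cell_kernel_operator_agreeing:
  fixes N :: "'b measure"
  assumes N: "sigma_finite_measure N" and nonnull: "emeasure N (space N) \<noteq> 0"
    and S: "stochastic_operator N M S" and F: "simple_function N F"
  obtains T where "stochastic_integral_operator N M T" and "stochastic_operator N M T"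
    and "\<And>g \<phi>. integrable N g \<Longrightarrow> (\<And>y. g y = \<phi> (F y)) \<Longrightarrow> AE x in M. T g x = S g x"
proof -
  obtain d where d: "\<And>v. prob_density M (d v)"
    and Sd: "\<And>c g v. integrable N g \<Longrightarrow> v \<in> F ` space N \<Longrightarrow> (\<forall>y\<in>cell N F v. g y = c) \<Longrightarrow>
          AE x in M. S (\<lambda>y. indicator (cell N F v) y * g y) x
            = (LINT y|N. indicator (cell N F v) y * g y) * d v x"
    using exists_cell_densities[OF assms] by blast
  note L = stochastic_linear[OF S]
  have fin: "finite (F ` space N)" using F by (simp add: simple_function_def)
  show thesis
  proof (rule that)
    fix g :: "'b \<Rightarrow> real" and \<phi>
    assume g: "integrable N g" and \<phi>: "\<And>y. g y = \<phi> (F y)"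
    let ?s = "\<lambda>y. \<Sum>v\<in>F ` space N. indicator (cell N F v) y * g y"
    have "AE x in M. S g x = S ?s x"
      using integrable_on_cell[OF F g] sum_over_cells[OF fin]
      by (intro L1_linear_cong_AE[OF L g]) (auto intro!: AE_I2)
    moreover have "AE x in M. S ?s x
        = (\<Sum>v\<in>F ` space N. S (\<lambda>y. indicator (cell N F v) y * g y) x)"
      using integrable_on_cell[OF F g] by (intro L1_linear_sum[OF L fin])
    moreover have "AE x in M. \<forall>v\<in>F ` space N. S (\<lambda>y. indicator (cell N F v) y * g y) x
        = (LINT y|N. indicator (cell N F v) y * g y) * d v x"
      using fin by (intro AE_finite_allI Sd[OF g]) (auto simp: \<phi>)
    ultimately show "AE x in M. cell_kernel_operator N d F g x = S g x"
      unfolding cell_kernel_operator_eq_sum[OF F g] by eventually_elim simp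
  qed (use cell_kernel_operator_integral_operator[OF F d]
      cell_kernel_operator_stochastic[OF F d] in auto)
qed

section \<open>Approximation of a finite-dimensional subspace\<close>

text \<open>
  The simple functions converge pointwise and satisfy \<open>\<bar>s k\<bar> \<le> 2 \<bar>f\<bar>\<close>, so that \<open>3 \<bar>f\<bar>\<close> dominates
  the error.
\<close>
lemma L1_approximation_by_simple_functions:
  fixes f :: "'b \<Rightarrow> real"
  assumes f: "integrable N f"
  obtains s where "\<And>k. simple_function N (s k)" and "\<And>k::nat. integrable N (s k)"
    and "(\<lambda>k. L1_norm N (\<lambda>y. f y - s k y)) \<longlonglongrightarrow> 0"
proof -
  have [measurable]: "f \<in> borel_measurable N" using f by auto
  obtain s where s: "\<And>k. simple_function N (s k)"
      "\<And>y. y \<in> space N \<Longrightarrow> (\<lambda>k. s k y) \<longlonglongrightarrow> f y"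
      "\<And>k y. y \<in> space N \<Longrightarrow> \<bar>s k y\<bar> \<le> 2 * \<bar>f y\<bar>"
    using borel_measurable_implies_sequence_metric[OF \<open>f \<in> borel_measurable N\<close>, of 0]
    unfolding dist_real_def diff_0_right by blast
  have [measurable]: "s k \<in> borel_measurable N" for k
    using s(1) by (rule borel_measurable_simple_function)
  have int: "integrable N (s k)" for k
    by (rule Bochner_Integration.integrable_bound[of N "\<lambda>y. 2 * f y"])
      (use f s(3) in \<open>auto intro!: AE_I2 simp: abs_mult\<close>)
  have "(\<lambda>k. LINT y|N. \<bar>f y - s k y\<bar>) \<longlonglongrightarrow> (LINT y|N. 0)"
  proof (rule integral_dominated_convergence[where w = "\<lambda>y. 3 * \<bar>f y\<bar>"])
    show "AE y in N. (\<lambda>k. \<bar>f y - s k y\<bar>) \<longlonglongrightarrow> 0"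
    proof (rule AE_I2)
      fix y assume "y \<in> space N"
      from tendsto_rabs[OF tendsto_diff[OF tendsto_const[of "f y"] s(2)[OF this]]]
      show "(\<lambda>k. \<bar>f y - s k y\<bar>) \<longlonglongrightarrow> 0" by simp
    qed
    show "AE y in N. norm \<bar>f y - s k y\<bar> \<le> 3 * \<bar>f y\<bar>" for k
    proof (rule AE_I2)
      fix y assume "y \<in> space N"
      from s(3)[OF this, of k] show "norm \<bar>f y - s k y\<bar> \<le> 3 * \<bar>f y\<bar>" by simp
    qed
  qed (use f in auto)
  then show thesis using that[of s] s(1) int by (simp add: L1_norm_def)
qed

lemma L1_norm_sum_le:
  assumes "finite B" and "\<And>b. b \<in> B \<Longrightarrow> integrable N (h b)"
  shows "L1_norm N (\<lambda>y. \<Sum>b\<in>B. c b * h b y) \<le> (\<Sum>b\<in>B. \<bar>c b\<bar> * L1_norm N (h b))"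
proof -
  have "L1_norm N (\<lambda>y. \<Sum>b\<in>B. c b * h b y) \<le> (LINT y|N. (\<Sum>b\<in>B. \<bar>c b\<bar> * \<bar>h b y\<bar>))"
    unfolding L1_norm_def
    by (rule integral_mono)
      (use assms in \<open>auto simp: abs_mult intro!: order_trans[OF sum_abs]\<close>)
  also have "\<dots> = (\<Sum>b\<in>B. \<bar>c b\<bar> * L1_norm N (h b))"
    unfolding L1_norm_def using assms by (subst Bochner_Integration.integral_sum) auto
  finally show ?thesis .
qed

text \<open>
  The fibres of the joint map form the common refinement of the partitions given by the single
  functions; \<open>restrict\<close> keeps its range inside a finite product.
\<close>
lemma simple_function_joint:
  assumes "finite B" and s: "\<And>b. b \<in> B \<Longrightarrow> simple_function N (s b)"
  shows "simple_function N (\<lambda>y. \<lambda>b\<in>B. s b y)"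
  unfolding simple_function_def
proof (intro conjI ballI)
  have "(\<lambda>y. \<lambda>b\<in>B. s b y) ` space N \<subseteq> (\<Pi>\<^sub>E b\<in>B. s b ` space N)" by auto
  then show "finite ((\<lambda>y. \<lambda>b\<in>B. s b y) ` space N)"
    by (rule finite_subset) (use assms in \<open>auto intro!: finite_PiE simp: simple_function_def\<close>)
next
  fix v assume "v \<in> (\<lambda>y. \<lambda>b\<in>B. s b y) ` space N"
  then have "(\<lambda>y. \<lambda>b\<in>B. s b y) -` {v} \<inter> space N = {y \<in> space N. \<forall>b\<in>B. s b y = v b}"
    by (auto simp: fun_eq_iff restrict_def split: if_splits)
  moreover have "{y \<in> space N. s b y = v b} \<in> sets N" if "b \<in> B" for b
  proof -
    have "{y \<in> space N. s b y = v b} = s b -` {v b} \<inter> space N" by auto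
    then show ?thesis using simple_functionD(2)[OF s[OF that], of "{v b}"] by simp
  qed
  ultimately show "(\<lambda>y. \<lambda>b\<in>B. s b y) -` {v} \<inter> space N \<in> sets N"
    using \<open>finite B\<close> by (simp add: sets.sets_Collect_finite_All')
qed

theorem theorem3p6:
  fixes M :: "'a measure" and N :: "'b measure"
    and S :: "('b \<Rightarrow> real) \<Rightarrow> 'a \<Rightarrow> real"
    and V :: "('b \<Rightarrow> real) set"
  assumes "sigma_finite_measure M" and "sigma_finite_measure N"
    and "stochastic_operator N M S"
    and "L1_subspace N V" and "L1_finite_dimensional N V"
  shows "\<exists>T :: nat \<Rightarrow> ('b \<Rightarrow> real) \<Rightarrow> 'a \<Rightarrow> real.
           (\<forall>k. stochastic_integral_operator N M (T k)) \<and>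
           (\<forall>f\<in>V. (\<lambda>k. L1_norm M (\<lambda>x. T k f x - S f x)) \<longlonglongrightarrow> 0)"
proof (cases "emeasure N (space N) = 0")
  case True
  \<comment> \<open>Here \<open>L\<^sup>1(N)\<close> is trivial, and there need not be any density on \<open>M\<close>, which may be null as well.
    The zero kernel is stochastic because its normalisation is required only almost everywhere.\<close>
  then have null: "AE y in N. P y" for P
    by (metis ae_filter_eq_bot_iff eventually_bot)
  have "stochastic_kernel N M (\<lambda>z. 0)"
    unfolding stochastic_kernel_def using null by auto
  then have "stochastic_integral_operator N M (\<lambda>g x. 0)"
    unfolding stochastic_integral_operator_def L1_linear_operator_def
    by (auto intro!: exI[of _ "\<lambda>z. 0"])
  moreover have "L1_norm M (\<lambda>x. 0 - S f x) = 0" if "f \<in> V" for f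
  proof -
    have f: "integrable N f" using that assms(4) by (simp add: L1_subspace_def)
    note L = stochastic_linear[OF assms(3)]
    have "AE x in M. S f x = S (\<lambda>y. 0) x"
      by (rule L1_linear_cong_AE[OF L f _ null]) simp
    then have "AE x in M. \<bar>0 - S f x\<bar> = 0"
      using L1_linear_zero[OF L] by eventually_elim simp
    then show ?thesis
      unfolding L1_norm_def by (rule integral_eq_zero_AE)
  qed
  ultimately show ?thesis
    by (intro exI[of _ "\<lambda>k g x. 0"]) auto
next
  case nonnull: False
  have V: "integrable N f" if "f \<in> V" for f
    using that assms(4) by (simp add: L1_subspace_def)
  obtain B where B: "finite B" "B \<subseteq> V"
    and span: "\<And>f. f \<in> V \<Longrightarrow> \<exists>c. AE y in N. f y = (\<Sum>b\<in>B. c b * b y)"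
    using assms(5) unfolding L1_finite_dimensional_def by blast
  have "\<exists>s. (\<forall>k::nat. simple_function N (s k) \<and> integrable N (s k)) \<and>
      (\<lambda>k. L1_norm N (\<lambda>y. b y - s k y)) \<longlonglongrightarrow> 0" if "b \<in> B" for b
  proof -
    have "integrable N b" using V that B(2) by blast
    then show ?thesis by (rule L1_approximation_by_simple_functions) blast
  qed
  then obtain s where s: "\<And>b k. b \<in> B \<Longrightarrow> simple_function N (s b k)"
    "\<And>b k. b \<in> B \<Longrightarrow> integrable N (s b k)"
    "\<And>b. b \<in> B \<Longrightarrow> (\<lambda>k. L1_norm N (\<lambda>y. b y - s b (k::nat) y)) \<longlonglongrightarrow> 0"
    by metis
  define F where "F k y = (\<lambda>b\<in>B. s b k y)" for k y
  have F: "simple_function N (F k)" for k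
    unfolding F_def[abs_def] using B(1) s(1) by (rule simple_function_joint)
  have "\<exists>T. stochastic_integral_operator N M T \<and> stochastic_operator N M T \<and>
      (\<forall>g \<phi>. integrable N g \<longrightarrow> (\<forall>y. g y = \<phi> (F k y)) \<longrightarrow> (AE x in M. T g x = S g x))" for k
    by (rule exists_cell_kernel_operator_agreeing[OF assms(2) nonnull assms(3) F[of k]]) blast
  then obtain T where T: "\<And>k. stochastic_integral_operator N M (T k)"
    "\<And>k. stochastic_operator N M (T k)"
    "\<And>k g \<phi>. integrable N g \<Longrightarrow> (\<And>y. g y = \<phi> (F k y)) \<Longrightarrow> AE x in M. T k g x = S g x"
    by metis
  have "(\<lambda>k. L1_norm M (\<lambda>x. T k f x - S f x)) \<longlonglongrightarrow> 0" if f: "f \<in> V" for f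
  proof -
    obtain c where c: "AE y in N. f y = (\<Sum>b\<in>B. c b * b y)" using span[OF f] by blast
    define g where "g k y = (\<Sum>b\<in>B. c b * s b k y)" for k y
    have g: "integrable N (g k)" for k
      unfolding g_def[abs_def] using s(2) by auto
    have agree: "AE x in M. T k (g k) x = S (g k) x" for k
      by (rule T(3)[where \<phi> = "\<lambda>v. \<Sum>b\<in>B. c b * v b"]) (auto simp: g F_def g_def)
    have bound: "L1_norm M (\<lambda>x. T k f x - S f x)
        \<le> 2 * (\<Sum>b\<in>B. \<bar>c b\<bar> * L1_norm N (\<lambda>y. b y - s b k y))" for k
    proof -
      have int: "integrable N (\<lambda>y. b y - s b k y)" if "b \<in> B" for b
        using V s(2) that B(2) by (intro Bochner_Integration.integrable_diff) auto
      have "AE y in N. \<bar>f y - g k y\<bar> = \<bar>\<Sum>b\<in>B. c b * (b y - s b k y)\<bar>"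
        using c by eventually_elim (simp add: g_def right_diff_distrib sum_subtractf)
      then have "L1_norm N (\<lambda>y. f y - g k y) = L1_norm N (\<lambda>y. \<Sum>b\<in>B. c b * (b y - s b k y))"
        unfolding L1_norm_def
      proof (intro integral_cong_AE)
        show "(\<lambda>y. \<bar>f y - g k y\<bar>) \<in> borel_measurable N" using V[OF f] g[of k] by auto
        show "(\<lambda>y. \<bar>\<Sum>b\<in>B. c b * (b y - s b k y)\<bar>) \<in> borel_measurable N"
          by (intro borel_measurable_abs borel_measurable_sum borel_measurable_times
              borel_measurable_const borel_measurable_integrable int)
      qed
      also have "\<dots> \<le> (\<Sum>b\<in>B. \<bar>c b\<bar> * L1_norm N (\<lambda>y. b y - s b k y))"
        by (rule L1_norm_sum_le[OF B(1), where h = "\<lambda>b y. b y - s b k y"]) (rule int)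
      finally show ?thesis
        using L1_dist_le_of_agreement[where S = S and T = "T k" and f = f and g = "g k",
            OF assms(3) T(2) V[OF f] g agree] by simp
    qed
    have "(\<lambda>k. 2 * (\<Sum>b\<in>B. \<bar>c b\<bar> * L1_norm N (\<lambda>y. b y - s b k y)))
        \<longlonglongrightarrow> 2 * (\<Sum>b\<in>B. \<bar>c b\<bar> * 0)"
      by (intro tendsto_intros s(3))
    then have lim: "(\<lambda>k. 2 * (\<Sum>b\<in>B. \<bar>c b\<bar> * L1_norm N (\<lambda>y. b y - s b k y))) \<longlonglongrightarrow> 0" by simp
    show ?thesis
      by (rule tendsto_sandwich[OF _ _ tendsto_const lim])
        (use bound in \<open>auto simp: L1_norm_def\<close>)
  qed
  with T(1) show ?thesis by blast
qed

end
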